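(* For every positive integer $k$ there exists a $k$-antichain $A$ in $[0,1]^2$ such that $\mathcal{H}^1(A)=2k$.
   Context: For $\mathbf{x}=(x_1,x_2)$ and $\mathbf{y}=(y_1,y_2)$ in $\mathbb{R}^2$, write $\mathbf{x}\le\mathbf{y}$ if $x_1\le y_1$ and $x_2\le y_2$. A set $C\subset[0,1]^2$ is a chain in $[0,1]^2$ if for all $\mathbf{x},\mathbf{y}\in C$ either $\mathbf{x}\le\mathbf{y}$ or $\mathbf{y}\le\mathbf{x}$. For a positive integer $k$, a $k$-antichain in $[0,1]^2$ is a set $A\subset[0,1]^2$ such that $A\cap C$ has at most $k$ elements for every chain $C\subset[0,1]^2$. $\mathcal{H}^1$ denotes the $1$-dimensional Hausdorff outer measure on $\mathbb{R}^2$ with respect to the Euclidean metric, normalized so that the measure of a line segment is its length. *)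

theory Defs
  imports "HOL-Analysis.Analysis"
begin

text \<open>The plane is \<^typ>\<open>real \<times> real\<close>: its metric is Euclidean (\<open>dist_prod_def\<close>)
  and its order is componentwise (\<open>less_eq_prod_def\<close>).\<close>

abbreviation unit_square :: "(real \<times> real) set" where
  "unit_square \<equiv> {0..1} \<times> {0..1}"

definition k_antichain :: "nat \<Rightarrow> (real \<times> real) set \<Rightarrow> bool" where
  "k_antichain k A \<longleftrightarrow> A \<subseteq> unit_square \<and>
     (\<forall>C. C \<subseteq> unit_square \<and> Complete_Partial_Order.chain (\<le>) C \<longrightarrow>
        finite (A \<inter> C) \<and> card (A \<inter> C) \<le> k)"

text \<open>One-dimensional Hausdorff outer measure. Covering sets must be bounded because
  \<^const>\<open>diameter\<close> is real-valued and carries no information for unbounded sets.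
  Finite covers are included, since \<^term>\<open>diameter {} = 0\<close>. In dimension one, summing the
  diameters without a further constant gives a line segment its length as measure.\<close>

definition hausdorff1_pre :: "real \<Rightarrow> 'a::metric_space set \<Rightarrow> ennreal" where
  "hausdorff1_pre \<delta> A =
     (INF U \<in> {U :: nat \<Rightarrow> 'a set. A \<subseteq> (\<Union>i. U i) \<and> (\<forall>i. bounded (U i) \<and> diameter (U i) \<le> \<delta>)}.
        \<Sum>i. ennreal (diameter (U i)))"

definition hausdorff1 :: "'a::metric_space set \<Rightarrow> ennreal" where
  "hausdorff1 A = (SUP \<delta> \<in> {0<..}. hausdorff1_pre \<delta> A)"

end

theory Submission
  imports Defs
begin

text \<open>For \<open>0 < p < 1 / 2\<close> let \<open>F\<close> be the Riesz-Nagy function with parameter \<open>p\<close>, the strictly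
  increasing distribution function on the unit interval that gives the left half of each dyadic
  interval the fraction \<open>p\<close> of its mass. The decreasing graph of \<open>1 - F\<close> is an antichain, and graphs for
  different \<open>p\<close> meet only at the corners, so \<open>k\<close> parameters give a \<open>k\<close>-antichain. Cut each graph
  into its \<open>2 ^ n\<close> dyadic arcs, with side lengths \<open>a = 1 / 2 ^ n\<close> and \<open>b\<close>. An arc has diameter at
  most \<open>a + b\<close>, so a graph has measure at most 2. By projection to the axes an arc has measure
  at least \<open>max a b \<ge> a + b - sqrt (a * b)\<close>, and these bounds add up over disjoint compact arcs.
  The sum of \<open>sqrt (a * b)\<close> over the arcs is \<open>((sqrt p + sqrt (1 - p)) / sqrt 2) ^ n\<close>, which tends
  to 0 because \<open>p \<noteq> 1 / 2\<close>.\<close>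

section \<open>Hausdorff measure\<close>

lemma hausdorff1_mono: "A \<subseteq> B \<Longrightarrow> hausdorff1 A \<le> hausdorff1 B"
  unfolding hausdorff1_def hausdorff1_pre_def
  by (intro SUP_mono' INF_superset_mono order_refl) blast

text \<open>A finite cover becomes the sequence required by \<open>hausdorff1_pre\<close> after
  padding with empty sets, whose diameter is 0. The free index type allows covers indexed by pairs
  of a parameter and an arc number.\<close>

lemma hausdorff1_le_finite_covers:
  fixes A :: "'a::metric_space set"
  assumes "\<And>\<delta>. \<delta> > 0 \<Longrightarrow> \<exists>(I :: 'b set) U. finite I \<and> A \<subseteq> (\<Union>i\<in>I. U i) \<and>
     (\<forall>i\<in>I. bounded (U i) \<and> diameter (U i) \<le> \<delta>) \<and> (\<Sum>i\<in>I. diameter (U i)) \<le> M"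
  shows "hausdorff1 A \<le> ennreal M"
  unfolding hausdorff1_def
proof (rule SUP_least)
  fix \<delta> :: real assume "\<delta> \<in> {0<..}"
  then have \<delta>: "\<delta> > 0" by simp
  obtain I :: "'b set" and U where I: "finite I" and cov: "A \<subseteq> (\<Union>i\<in>I. U i)"
    and bd: "\<And>i. i \<in> I \<Longrightarrow> bounded (U i) \<and> diameter (U i) \<le> \<delta>"
    and sm: "(\<Sum>i\<in>I. diameter (U i)) \<le> M"
    using assms[OF \<delta>] by blast
  obtain h where h: "bij_betw h {0..<card I} I"
    using ex_bij_betw_nat_finite[OF I] by blast
  define V where "V = (\<lambda>n. if n < card I then U (h n) else {})"
  have hI: "h n \<in> I" if "n < card I" for n
    using h that by (auto simp: bij_betw_def)
  have "A \<subseteq> (\<Union>n. V n)"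
  proof
    fix x assume "x \<in> A"
    then obtain i where "i \<in> I" "x \<in> U i" using cov by blast
    moreover from this obtain n where "n < card I" "h n = i"
      using bij_betw_imp_surj_on[OF h] by (metis atLeastLessThan_iff imageE)
    ultimately show "x \<in> (\<Union>n. V n)" by (auto simp: V_def)
  qed
  moreover have "bounded (V n) \<and> diameter (V n) \<le> \<delta>" for n
    using bd[OF hI] \<delta> by (simp add: V_def)
  ultimately have "hausdorff1_pre \<delta> A \<le> (\<Sum>n. ennreal (diameter (V n)))"
    unfolding hausdorff1_pre_def by (intro INF_lower) simp
  also have "\<dots> = (\<Sum>n<card I. ennreal (diameter (V n)))"
    by (intro suminf_finite) (auto simp: V_def)
  also have "\<dots> = ennreal (\<Sum>n<card I. diameter (V n))"
    by (intro sum_ennreal) (auto simp: V_def bd hI intro!: diameter_ge_0)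
  also have "(\<Sum>n<card I. diameter (V n)) = (\<Sum>n\<in>{0..<card I}. diameter (U (h n)))"
    by (intro sum.cong) (auto simp: V_def)
  also have "\<dots> = (\<Sum>i\<in>I. diameter (U i))"
    by (rule sum.reindex_bij_betw[OF h])
  also have "ennreal \<dots> \<le> ennreal M" using sm by (rule ennreal_leI)
  finally show "hausdorff1_pre \<delta> A \<le> ennreal M" .
qed

section \<open>Lower bounds: separated unions and Lipschitz images\<close>

text \<open>A covering set of diameter below \<open>d\<close> cannot meet both \<open>S\<close> and
  \<open>T\<close>, so each cover of the union splits into covers of the two sets without counting
  any member twice. The scales \<open>\<delta>1\<close> and \<open>\<delta>2\<close> are separate so
  that the two suprema in \<open>hausdorff1\<close> can be taken independently.\<close>

lemma hausdorff1_pre_add_le: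
  fixes S T :: "'a::metric_space set"
  assumes "d > 0" and sep: "\<And>x y. x \<in> S \<Longrightarrow> y \<in> T \<Longrightarrow> d \<le> dist x y"
    and "\<delta> \<le> \<delta>1" "\<delta> \<le> \<delta>2" "\<delta> < d" "0 < \<delta>"
  shows "hausdorff1_pre \<delta>1 S + hausdorff1_pre \<delta>2 T \<le> hausdorff1_pre \<delta> (S \<union> T)"
  unfolding hausdorff1_pre_def[of \<delta>]
proof (rule INF_greatest)
  fix U :: "nat \<Rightarrow> 'a set"
  assume "U \<in> {U. S \<union> T \<subseteq> (\<Union>i. U i) \<and> (\<forall>i. bounded (U i) \<and> diameter (U i) \<le> \<delta>)}"
  then have cov: "S \<union> T \<subseteq> (\<Union>i. U i)" and U: "\<And>i. bounded (U i)" "\<And>i. diameter (U i) \<le> \<delta>"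
    by auto
  \<comment> \<open>Members that miss \<open>X\<close> are replaced by the empty set, of diameter 0,
    which keeps the indexing by \<open>nat\<close>.\<close>
  define part where "part = (\<lambda>X i. if U i \<inter> X = {} then {} else U i)"
  have pre: "hausdorff1_pre \<epsilon> X \<le> (\<Sum>i. ennreal (diameter (part X i)))"
    if "X \<subseteq> S \<union> T" "\<delta> \<le> \<epsilon>" for X \<epsilon>
    unfolding hausdorff1_pre_def
  proof (rule INF_lower, safe)
    fix x assume "x \<in> X"
    then show "x \<in> (\<Union>i. part X i)" using cov that(1) by (fastforce simp: part_def)
  next
    fix i show "bounded (part X i)" "diameter (part X i) \<le> \<epsilon>"
      using U[of i] that(2) \<open>0 < \<delta>\<close> by (auto simp: part_def)
  qed
  have disj: "part S i = {} \<or> part T i = {}" for i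
  proof (rule ccontr)
    assume "\<not> ?thesis"
    then obtain x y where "x \<in> U i" "x \<in> S" "y \<in> U i" "y \<in> T"
      by (auto simp: part_def split: if_splits)
    then have "d \<le> diameter (U i)"
      using sep diameter_bounded_bound[OF U(1)] by fastforce
    then show False using U(2)[of i] \<open>\<delta> < d\<close> by linarith
  qed
  have le: "ennreal (diameter (part S i)) + ennreal (diameter (part T i)) \<le> ennreal (diameter (U i))" for i
    using disj[of i]
    by (cases "U i \<inter> S = {}"; cases "U i \<inter> T = {}") (simp_all add: part_def)
  have "hausdorff1_pre \<delta>1 S + hausdorff1_pre \<delta>2 T
      \<le> (\<Sum>i. ennreal (diameter (part S i))) + (\<Sum>i. ennreal (diameter (part T i)))"
    using assms by (intro add_mono pre) auto
  also have "\<dots> = (\<Sum>i. ennreal (diameter (part S i)) + ennreal (diameter (part T i)))"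
    by (intro suminf_add) auto
  also have "\<dots> \<le> (\<Sum>i. ennreal (diameter (U i)))"
    by (intro suminf_le le) auto
  finally show "hausdorff1_pre \<delta>1 S + hausdorff1_pre \<delta>2 T \<le> (\<Sum>i. ennreal (diameter (U i)))" .
qed

lemma hausdorff1_add_le:
  fixes S T :: "'a::metric_space set"
  assumes "d > 0" and sep: "\<And>x y. x \<in> S \<Longrightarrow> y \<in> T \<Longrightarrow> d \<le> dist x y"
  shows "hausdorff1 S + hausdorff1 T \<le> hausdorff1 (S \<union> T)"
proof -
  have le: "hausdorff1_pre \<delta>1 S + hausdorff1_pre \<delta>2 T \<le> hausdorff1 (S \<union> T)"
    if "\<delta>1 \<in> {0<..}" "\<delta>2 \<in> {0<..}" for \<delta>1 \<delta>2
  proof -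
    \<comment> \<open>Below both scales, and by the factor 1/2 strictly below the separation
      \<open>d\<close>.\<close>
    define \<delta> where "\<delta> = min (min \<delta>1 \<delta>2) (d / 2)"
    have "hausdorff1_pre \<delta>1 S + hausdorff1_pre \<delta>2 T \<le> hausdorff1_pre \<delta> (S \<union> T)"
      using that assms(1) by (intro hausdorff1_pre_add_le[OF assms]) (auto simp: \<delta>_def)
    also have "\<dots> \<le> hausdorff1 (S \<union> T)"
      unfolding hausdorff1_def using that assms(1) by (intro SUP_upper) (auto simp: \<delta>_def)
    finally show ?thesis .
  qed
  have "hausdorff1_pre \<delta>1 S + hausdorff1 T \<le> hausdorff1 (S \<union> T)" if "\<delta>1 \<in> {0<..}" for \<delta>1
    unfolding hausdorff1_def[of T]
    by (subst ennreal_SUP_add_right) (auto intro!: SUP_least le that)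
  then show ?thesis
    unfolding hausdorff1_def[of S]
    by (subst ennreal_SUP_add_left[symmetric]) (auto intro!: SUP_least)
qed

text \<open>Disjoint compact sets have positive distance, so \<open>hausdorff1_add_le\<close>
  applies at each step of an induction over the index set.\<close>

lemma sum_hausdorff1_le:
  fixes K :: "'b \<Rightarrow> 'a::heine_borel set"
  assumes "finite I" "\<And>i. i \<in> I \<Longrightarrow> compact (K i)" "disjoint_family_on K I"
  shows "(\<Sum>i\<in>I. hausdorff1 (K i)) \<le> hausdorff1 (\<Union>i\<in>I. K i)"
  using assms
proof (induction I rule: finite_induct)
  case (insert i I)
  have "compact (K i)" "compact (\<Union>j\<in>I. K j)" using insert by auto
  moreover have "K i \<inter> (\<Union>j\<in>I. K j) = {}"
    using insert by (auto simp: disjoint_family_on_def)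
  ultimately obtain d where "d > 0" "\<forall>x\<in>K i. \<forall>y\<in>(\<Union>j\<in>I. K j). d \<le> dist x y"
    using separate_compact_closed[of "K i" "\<Union>j\<in>I. K j"] compact_imp_closed by blast
  then have "hausdorff1 (K i) + hausdorff1 (\<Union>j\<in>I. K j) \<le> hausdorff1 (K i \<union> (\<Union>j\<in>I. K j))"
    by (intro hausdorff1_add_le[of d]) auto
  moreover have "(\<Sum>i\<in>I. hausdorff1 (K i)) \<le> hausdorff1 (\<Union>j\<in>I. K j)"
    using insert by (auto simp: disjoint_family_on_def)
  ultimately show ?case using insert(1,2)
    by simp (meson add_left_mono order.trans)
qed auto

text \<open>A 1-Lipschitz function maps each covering set into an interval as long as its diameter.
  These intervals cover \<open>{a..b}\<close>, so Lebesgue measure bounds the sum of diameters from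
  below.\<close>

lemma hausdorff1_ge_of_lipschitz:
  fixes A :: "'a::metric_space set" and g :: "'a \<Rightarrow> real"
  assumes lip: "\<And>x y. dist (g x) (g y) \<le> dist x y" and sub: "{a..b} \<subseteq> g ` A"
  shows "ennreal (b - a) \<le> hausdorff1 A"
proof (cases "a \<le> b")
  case True
  \<comment> \<open>\<open>hausdorff1\<close> is a supremum over scales, so a bound at one scale is
    enough.\<close>
  have "ennreal (b - a) \<le> hausdorff1_pre 1 A"
    unfolding hausdorff1_pre_def
  proof (rule INF_greatest)
    fix U :: "nat \<Rightarrow> 'a set"
    assume "U \<in> {U. A \<subseteq> (\<Union>i. U i) \<and> (\<forall>i. bounded (U i) \<and> diameter (U i) \<le> 1)}"
    then have cov: "A \<subseteq> (\<Union>i. U i)" and bd: "\<And>i. bounded (U i)" by auto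
    \<comment> \<open>If \<open>U i\<close> is empty, this is one point at an unspecified position,
      of length 0.\<close>
    define V where "V = (\<lambda>i. {Inf (g ` U i) .. Inf (g ` U i) + diameter (U i)})"
    have gV: "g x \<in> V i" if x: "x \<in> U i" for x i
    proof -
      have le: "g x - diameter (U i) \<le> g y" if "y \<in> U i" for y
        using lip[of x y, unfolded dist_real_def] diameter_bounded_bound[OF bd x that] by linarith
      then have "g x - diameter (U i) \<le> Inf (g ` U i)"
        using x by (intro cINF_greatest) auto
      moreover have "Inf (g ` U i) \<le> g x"
        using x le by (intro cINF_lower bdd_belowI2[where m = "g x - diameter (U i)"])
      ultimately show ?thesis by (auto simp: V_def)
    qed
    have "{a..b} \<subseteq> (\<Union>i. V i)"
    proof
      fix t assume "t \<in> {a..b}"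
      then obtain x where "x \<in> A" "t = g x" using sub by blast
      then show "t \<in> (\<Union>i. V i)" using cov gV by blast
    qed
    then have "emeasure lborel {a..b} \<le> emeasure lborel (\<Union>i. V i)"
      by (intro emeasure_mono) (auto simp: V_def)
    also have "\<dots> \<le> (\<Sum>i. emeasure lborel (V i))"
      by (intro emeasure_subadditive_countably) (auto simp: V_def)
    also have "\<dots> = (\<Sum>i. ennreal (diameter (U i)))"
      by (intro suminf_cong) (simp add: V_def diameter_ge_0 bd)
    finally show "ennreal (b - a) \<le> (\<Sum>i. ennreal (diameter (U i)))" using True by simp
  qed
  also have "\<dots> \<le> hausdorff1 A" unfolding hausdorff1_def by (intro SUP_upper) auto
  finally show ?thesis .
qed (simp add: ennreal_neg)

section \<open>The Riesz-Nagy singular functions\<close>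

text \<open>Extending by 0 to the left and by 1 to the right of the unit interval merges the two
  branches of de Rham's functional equation into one formula on the whole line.\<close>

primrec rn_approx :: "real \<Rightarrow> nat \<Rightarrow> real \<Rightarrow> real" where
  "rn_approx p 0 x = max 0 (min 1 x)"
| "rn_approx p (Suc n) x = p * rn_approx p n (2 * x) + (1 - p) * rn_approx p n (2 * x - 1)"

definition riesz_nagy :: "real \<Rightarrow> real \<Rightarrow> real" where
  "riesz_nagy p x = lim (\<lambda>n. rn_approx p n x)"

section \<open>Approximants and their uniform limit\<close>

lemma rn_approx_outside: "x \<le> 0 \<Longrightarrow> rn_approx p n x = 0" "1 \<le> x \<Longrightarrow> rn_approx p n x = 1"
  by (induction n arbitrary: x) auto

lemma continuous_on_rn_approx: "continuous_on UNIV (rn_approx p n)"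
proof (induction n)
  case (Suc n)
  have "rn_approx p (Suc n) = (\<lambda>x. p * rn_approx p n (2 * x) + (1 - p) * rn_approx p n (2 * x - 1))"
    by (simp add: fun_eq_iff)
  then show ?case
    by (simp only:) (intro continuous_intros continuous_on_compose2[OF Suc] subset_UNIV)
next
  case 0
  have "rn_approx p 0 = (\<lambda>x. max 0 (min 1 x))" by (simp add: fun_eq_iff)
  then show ?case by (simp only:) (intro continuous_intros)
qed

lemma rn_approx_mono:
  assumes "0 \<le> p" "p \<le> 1" "x \<le> y"
  shows "rn_approx p n x \<le> rn_approx p n y"
  using assms(3)
proof (induction n arbitrary: x y)
  case (Suc n)
  then show ?case using assms(1,2) by (auto intro!: add_mono mult_left_mono Suc.IH)
qed auto

text \<open>By monotonicity in \<open>x\<close> the weight \<open>p\<close> sits on the larger of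
  the two values being averaged, so raising it raises the average.\<close>

lemma rn_approx_mono_param:
  assumes "0 \<le> p" "p \<le> r" "r \<le> 1"
  shows "rn_approx p n x \<le> rn_approx r n x"
proof (induction n arbitrary: x)
  case (Suc n)
  let ?a = "rn_approx p n (2 * x)" and ?b = "rn_approx p n (2 * x - 1)"
  have "(r - p) * ?b \<le> (r - p) * ?a"
    using assms by (intro mult_left_mono rn_approx_mono) auto
  then have "p * ?a + (1 - p) * ?b \<le> r * ?a + (1 - r) * ?b" by (simp add: algebra_simps)
  also have "\<dots> \<le> r * rn_approx r n (2 * x) + (1 - r) * rn_approx r n (2 * x - 1)"
    using assms by (intro add_mono mult_left_mono Suc.IH) auto
  finally show ?case by simp
qed auto

text \<open>At most one of \<open>2 * x\<close> and \<open>2 * x - 1\<close> lies strictly inside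
  the unit interval. At the other all approximants agree, so a recursion step multiplies the
  difference by just one of the weights.\<close>

lemma rn_approx_diff_le:
  assumes "0 \<le> p" "p \<le> 1"
  shows "\<bar>rn_approx p (Suc n) x - rn_approx p n x\<bar> \<le> max p (1 - p) ^ n"
proof (induction n arbitrary: x)
  case 0
  have b: "0 \<le> rn_approx p n x \<and> rn_approx p n x \<le> 1" for n x
    using rn_approx_mono[OF assms, of 0 x n] rn_approx_mono[OF assms, of x 1 n]
      rn_approx_outside[of x p n] rn_approx_outside(1)[of 0 p n] rn_approx_outside(2)[of 1 p n]
    by linarith
  show ?case using b[of "Suc 0" x] b[of 0 x] by (simp only: power_0) linarith
next
  case (Suc n)
  let ?d = "\<lambda>x. rn_approx p (Suc n) x - rn_approx p n x"
  let ?m = "max p (1 - p)"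
  have eq: "rn_approx p (Suc (Suc n)) x - rn_approx p (Suc n) x = p * ?d (2 * x) + (1 - p) * ?d (2 * x - 1)"
    by (simp only: rn_approx.simps(2)[of p "Suc n"] rn_approx.simps(2)[of p n x]) (simp only: algebra_simps)
  have "\<bar>p * ?d (2 * x) + (1 - p) * ?d (2 * x - 1)\<bar> \<le> ?m * ?m ^ n"
  proof (cases "x \<le> 1 / 2")
    case True
    then have "?d (2 * x - 1) = 0" by (simp only: rn_approx_outside)
    moreover have "\<bar>p * ?d (2 * x)\<bar> \<le> ?m * ?m ^ n"
      unfolding abs_mult using assms by (intro mult_mono Suc.IH) auto
    ultimately show ?thesis by simp
  next
    case False
    then have "?d (2 * x) = 0" by (simp only: rn_approx_outside)
    moreover have "\<bar>(1 - p) * ?d (2 * x - 1)\<bar> \<le> ?m * ?m ^ n"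
      unfolding abs_mult using assms by (intro mult_mono Suc.IH) auto
    ultimately show ?thesis by simp
  qed
  then show ?case by (simp only: eq power_Suc)
qed

text \<open>The bounds of \<open>rn_approx_diff_le\<close> form a convergent geometric series; the
  M-test applies to the telescoping sum of differences.\<close>

lemma uniform_limit_rn_approx:
  assumes "0 < p" "p < 1"
  shows "uniform_limit UNIV (rn_approx p) (riesz_nagy p) sequentially"
proof -
  let ?d = "\<lambda>n x. rn_approx p (Suc n) x - rn_approx p n x"
  have "uniform_limit UNIV (\<lambda>n x. \<Sum>i<n. ?d i x) (\<lambda>x. suminf (\<lambda>i. ?d i x)) sequentially"
    using assms rn_approx_diff_le[of p]
    by (intro Weierstrass_m_test[where M = "\<lambda>n. max p (1 - p) ^ n"]) (auto intro!: summable_geometric simp del: rn_approx.simps)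
  moreover have "(\<lambda>n x. \<Sum>i<n. ?d i x) = (\<lambda>n x. rn_approx p n x - rn_approx p 0 x)"
    by (intro ext sum_lessThan_telescope)
  ultimately have "uniform_limit UNIV (\<lambda>n x. rn_approx p n x - rn_approx p 0 x + rn_approx p 0 x)
      (\<lambda>x. suminf (\<lambda>i. ?d i x) + rn_approx p 0 x) sequentially"
    by (intro uniform_limit_intros) (simp only:)
  then have lim: "uniform_limit UNIV (rn_approx p) (\<lambda>x. suminf (\<lambda>i. ?d i x) + rn_approx p 0 x) sequentially"
    by (simp only: diff_add_cancel)
  moreover have "riesz_nagy p = (\<lambda>x. suminf (\<lambda>i. ?d i x) + rn_approx p 0 x)"
    using tendsto_uniform_limitI[OF lim UNIV_I] by (auto simp: riesz_nagy_def fun_eq_iff intro!: limI simp del: rn_approx.simps)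
  ultimately show ?thesis by simp
qed

lemma LIMSEQ_rn_approx: "0 < p \<Longrightarrow> p < 1 \<Longrightarrow> (\<lambda>n. rn_approx p n x) \<longlonglongrightarrow> riesz_nagy p x"
  using tendsto_uniform_limitI[OF uniform_limit_rn_approx] by blast

lemma continuous_on_riesz_nagy: "0 < p \<Longrightarrow> p < 1 \<Longrightarrow> continuous_on S (riesz_nagy p)"
  by (rule continuous_on_subset[OF uniform_limit_theorem[OF _ uniform_limit_rn_approx]])
     (auto simp: continuous_on_rn_approx)

section \<open>Functional equation and strict monotonicity\<close>

lemma riesz_nagy_outside:
  assumes "0 < p" "p < 1"
  shows "x \<le> 0 \<Longrightarrow> riesz_nagy p x = 0" "1 \<le> x \<Longrightarrow> riesz_nagy p x = 1"
  using LIMSEQ_rn_approx[OF assms, of x] by (auto simp: rn_approx_outside LIMSEQ_const_iff)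

lemma riesz_nagy_rec:
  assumes "0 < p" "p < 1"
  shows "riesz_nagy p x = p * riesz_nagy p (2 * x) + (1 - p) * riesz_nagy p (2 * x - 1)"
proof (rule LIMSEQ_unique)
  show "(\<lambda>n. rn_approx p (Suc n) x) \<longlonglongrightarrow> riesz_nagy p x"
    using LIMSEQ_rn_approx[OF assms] by (rule LIMSEQ_Suc)
  show "(\<lambda>n. rn_approx p (Suc n) x) \<longlonglongrightarrow> p * riesz_nagy p (2 * x) + (1 - p) * riesz_nagy p (2 * x - 1)"
    by (auto intro!: tendsto_intros LIMSEQ_rn_approx assms)
qed

lemma riesz_nagy_mono: "0 < p \<Longrightarrow> p < 1 \<Longrightarrow> x \<le> y \<Longrightarrow> riesz_nagy p x \<le> riesz_nagy p y"
  by (rule LIMSEQ_le[OF LIMSEQ_rn_approx LIMSEQ_rn_approx]) (auto intro!: rn_approx_mono)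

lemma riesz_nagy_bounds: "0 < p \<Longrightarrow> p < 1 \<Longrightarrow> 0 \<le> riesz_nagy p x \<and> riesz_nagy p x \<le> 1"
  using riesz_nagy_mono[of p 0 x] riesz_nagy_mono[of p x 1] riesz_nagy_outside[of p]
  by (metis linorder_linear order_refl zero_le_one)

text \<open>Repeated doubling brings \<open>x\<close> to at least 1, where the value is 1. By the
  recursion each doubling costs at most a factor \<open>p > 0\<close>.\<close>

lemma riesz_nagy_pos:
  assumes p: "0 < p" "p < 1" and "0 < x"
  shows "0 < riesz_nagy p x"
proof -
  have "0 < riesz_nagy p x" if "1 \<le> 2 ^ n * x" for n x
    using that
  proof (induction n arbitrary: x)
    case (Suc n)
    then have "0 < p * riesz_nagy p (2 * x)" using p by (simp add: mult_ac)
    moreover have "0 \<le> (1 - p) * riesz_nagy p (2 * x - 1)"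
      using p riesz_nagy_bounds[OF p] by simp
    ultimately show ?case by (subst riesz_nagy_rec[OF p]) linarith
  qed (simp add: riesz_nagy_outside p)
  moreover obtain n :: nat where "inverse x < 2 ^ n"
    using real_arch_pow[of 2 "inverse x"] by auto
  then have "1 \<le> 2 ^ n * x" using \<open>0 < x\<close> by (simp add: field_simps)
  ultimately show ?thesis by blast
qed

lemma riesz_nagy_less_1:
  assumes p: "0 < p" "p < 1" and "x < 1"
  shows "riesz_nagy p x < 1"
proof -
  \<comment> \<open>Here \<open>x\<close> is the distance to 1, which the right branch doubles:
    \<open>2 * (1 - x) - 1 = 1 - 2 * x\<close>.\<close>
  have "riesz_nagy p (1 - x) < 1" if "1 \<le> 2 ^ n * x" for n x
    using that
  proof (induction n arbitrary: x)
    case (Suc n)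
    then have "riesz_nagy p (1 - 2 * x) < 1" by (simp add: mult_ac)
    then have "(1 - p) * riesz_nagy p (2 * (1 - x) - 1) < 1 - p" using p by simp
    moreover have "p * riesz_nagy p (2 * (1 - x)) \<le> p"
      using p riesz_nagy_bounds[OF p] by simp
    ultimately show ?case by (subst riesz_nagy_rec[OF p]) linarith
  qed (simp add: riesz_nagy_outside p)
  moreover obtain n :: nat where "inverse (1 - x) < 2 ^ n"
    using real_arch_pow[of 2 "inverse (1 - x)"] by auto
  then have "1 \<le> 2 ^ n * (1 - x)" using \<open>x < 1\<close> by (simp add: field_simps)
  ultimately have "riesz_nagy p (1 - (1 - x)) < 1" by blast
  then show ?thesis by simp
qed

text \<open>Induction on the number of doublings that bring the gap \<open>y - x\<close> to at least
  1. Points in the same half are rescaled by the recursion; points on different sides of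
  \<open>1 / 2\<close> are separated by \<open>p\<close>, the value at \<open>1 / 2\<close>.\<close>

lemma riesz_nagy_strict_mono:
  assumes p: "0 < p" "p < 1" and "0 \<le> x" "x < y" "y \<le> 1"
  shows "riesz_nagy p x < riesz_nagy p y"
proof -
  have "riesz_nagy p x < riesz_nagy p y" if "1 \<le> 2 ^ n * (y - x)" "0 \<le> x" "y \<le> 1" for n x y
    using that
  proof (induction n arbitrary: x y)
    case 0
    then have "x = 0" "y = 1" by auto
    then show ?case by (simp add: riesz_nagy_outside p)
  next
    case (Suc n)
    have gap: "1 \<le> 2 ^ n * (2 * y - 2 * x)" "1 \<le> 2 ^ n * ((2 * y - 1) - (2 * x - 1))"
      using Suc.prems by (simp_all add: algebra_simps)
    have "0 < 2 ^ Suc n * (y - x)" using Suc.prems by linarith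
    then have "x < y" by (simp add: zero_less_mult_iff)
    consider "y \<le> 1 / 2" | "1 / 2 \<le> x" | "x < 1 / 2" "1 / 2 < y" by linarith
    then show ?case
    proof cases
      case 1
      then have "riesz_nagy p (2 * x) < riesz_nagy p (2 * y)" using Suc.prems gap by (intro Suc.IH) auto
      then show ?thesis using 1 \<open>x < y\<close> p
        by (simp add: riesz_nagy_rec[OF p, of x] riesz_nagy_rec[OF p, of y] riesz_nagy_outside(1)[OF p])
    next
      case 2
      then have "riesz_nagy p (2 * x - 1) < riesz_nagy p (2 * y - 1)" using Suc.prems gap by (intro Suc.IH) auto
      then show ?thesis using 2 \<open>x < y\<close> p
        by (simp add: riesz_nagy_rec[OF p, of x] riesz_nagy_rec[OF p, of y] riesz_nagy_outside(2)[OF p])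
    next
      case 3
      then have "riesz_nagy p x < p"
        using p riesz_nagy_less_1[OF p, of "2 * x"]
        by (simp add: riesz_nagy_rec[OF p, of x] riesz_nagy_outside(1)[OF p])
      moreover have "p \<le> riesz_nagy p y"
        using 3 p riesz_nagy_bounds[OF p, of "2 * y - 1"]
        by (simp add: riesz_nagy_rec[OF p, of y] riesz_nagy_outside(2)[OF p])
      ultimately show ?thesis by linarith
    qed
  qed
  moreover obtain n :: nat where "inverse (y - x) < 2 ^ n"
    using real_arch_pow[of 2 "inverse (y - x)"] by auto
  then have "1 \<le> 2 ^ n * (y - x)" using \<open>x < y\<close> by (simp add: field_simps)
  ultimately show ?thesis using assms by blast
qed

text \<open>Strictness comes from changing the weights at the first level alone, because the two
  averaged values differ when \<open>0 < x < 1\<close>; deeper levels contribute a weak inequality.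
  Hence distinct graphs meet only at their ends.\<close>

lemma riesz_nagy_strict_mono_param:
  assumes "0 < p" "p < r" "r < 1" "0 < x" "x < 1"
  shows "riesz_nagy p x < riesz_nagy r x"
proof -
  have p: "0 < p" "p < 1" and r: "0 < r" "r < 1" using assms by auto
  have le: "riesz_nagy p y \<le> riesz_nagy r y" for y
    using assms by (intro LIMSEQ_le[OF LIMSEQ_rn_approx[OF p] LIMSEQ_rn_approx[OF r]]) (auto intro!: rn_approx_mono_param)
  let ?a = "riesz_nagy p (2 * x)" and ?b = "riesz_nagy p (2 * x - 1)"
  have "?b < ?a"
  proof (cases "x \<le> 1 / 2")
    case True
    then show ?thesis using assms p by (simp add: riesz_nagy_outside(1)[OF p] riesz_nagy_pos)
  next
    case False
    then show ?thesis using assms p by (simp add: riesz_nagy_outside(2)[OF p] riesz_nagy_less_1)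
  qed
  then have "(r - p) * ?b < (r - p) * ?a" using assms by simp
  then have "p * ?a + (1 - p) * ?b < r * ?a + (1 - r) * ?b" by (simp add: algebra_simps)
  also have "\<dots> \<le> r * riesz_nagy r (2 * x) + (1 - r) * riesz_nagy r (2 * x - 1)"
    using r by (intro add_mono mult_left_mono le) auto
  finally show ?thesis by (simp add: riesz_nagy_rec[OF p, of x] riesz_nagy_rec[OF r, of x])
qed

section \<open>Dyadic increments\<close>

text \<open>The height of the \<open>i\<close>-th arc of level \<open>n\<close>, whose width is
  \<open>1 / 2 ^ n\<close>.\<close>

definition rn_incr :: "real \<Rightarrow> nat \<Rightarrow> nat \<Rightarrow> real" where
  "rn_incr p n i = riesz_nagy p (real (Suc i) / 2 ^ n) - riesz_nagy p (real i / 2 ^ n)"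

lemma rn_incr_nonneg: "0 < p \<Longrightarrow> p < 1 \<Longrightarrow> 0 \<le> rn_incr p n i"
  unfolding rn_incr_def by (simp add: riesz_nagy_mono divide_right_mono)

text \<open>A level is added at the coarse end: the first \<open>2 ^ n\<close> intervals of level
  \<open>Suc n\<close> fill the left half of the unit interval, where the function is
  \<open>p\<close> times a compressed copy of itself.\<close>

lemma rn_incr_left_half:
  assumes p: "0 < p" "p < 1" and "i < 2 ^ n"
  shows "rn_incr p (Suc n) i = p * rn_incr p n i"
proof -
  have "riesz_nagy p (real m / 2 ^ Suc n) = p * riesz_nagy p (real m / 2 ^ n)" if "m \<le> 2 ^ n" for m
  proof -
    have "real m \<le> 2 ^ n" using that by (metis of_nat_le_iff of_nat_numeral of_nat_power)
    then have "real m / 2 ^ n - 1 \<le> 0" by simp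
    then show ?thesis
      using riesz_nagy_rec[OF p, of "real m / 2 ^ Suc n"] riesz_nagy_outside(1)[OF p] by simp
  qed
  from this[of i] this[of "Suc i"] show ?thesis
    using assms(3) unfolding rn_incr_def right_diff_distrib by linarith
qed

lemma rn_incr_right_half:
  assumes p: "0 < p" "p < 1"
  shows "rn_incr p (Suc n) (2 ^ n + i) = (1 - p) * rn_incr p n i"
proof -
  have "riesz_nagy p (real (2 ^ n + m) / 2 ^ Suc n) = p + (1 - p) * riesz_nagy p (real m / 2 ^ n)"
    for m
  proof -
    have "2 * (real (2 ^ n + m) / 2 ^ Suc n) = 1 + real m / 2 ^ n" by (simp add: field_simps)
    then show ?thesis
      using riesz_nagy_rec[OF p, of "real (2 ^ n + m) / 2 ^ Suc n"]
        riesz_nagy_outside(2)[OF p, of "1 + real m / 2 ^ n"]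
      by simp
  qed
  from this[of i] this[of "Suc i"] show ?thesis
    unfolding rn_incr_def right_diff_distrib add_Suc_right by linarith
qed

lemma sum_lessThan_add: "(\<Sum>i<m + n. g i) = (\<Sum>i<m. g i) + (\<Sum>i<n. g (m + i))"
  for g :: "nat \<Rightarrow> 'a::comm_monoid_add"
  by (induction n) (simp_all add: add.assoc)

lemma sum_rn_incr: "0 < p \<Longrightarrow> p < 1 \<Longrightarrow> (\<Sum>i<2 ^ n. rn_incr p n i) = 1"
  using sum_lessThan_telescope[of "\<lambda>i. riesz_nagy p (real i / 2 ^ n)" "2 ^ n"]
  by (simp add: rn_incr_def riesz_nagy_outside)

text \<open>The two halves of level \<open>Suc n\<close> are copies of level \<open>n\<close> scaled
  by \<open>p\<close> and \<open>1 - p\<close>, and square roots respect the scaling.\<close>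

lemma sum_sqrt_rn_incr:
  assumes p: "0 < p" "p < 1"
  shows "(\<Sum>i<2 ^ n. sqrt (rn_incr p n i)) = (sqrt p + sqrt (1 - p)) ^ n"
proof (induction n)
  case 0
  show ?case by (simp add: rn_incr_def riesz_nagy_outside p)
next
  case (Suc n)
  have "(\<Sum>i<2 ^ Suc n. sqrt (rn_incr p (Suc n) i))
      = (\<Sum>i<2 ^ n. sqrt (rn_incr p (Suc n) i)) + (\<Sum>i<2 ^ n. sqrt (rn_incr p (Suc n) (2 ^ n + i)))"
    using sum_lessThan_add[of _ "2 ^ n" "2 ^ n"] by (simp add: mult_2)
  also have "\<dots> = sqrt p * (\<Sum>i<2 ^ n. sqrt (rn_incr p n i)) + sqrt (1 - p) * (\<Sum>i<2 ^ n. sqrt (rn_incr p n i))"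
    by (simp add: rn_incr_left_half rn_incr_right_half p real_sqrt_mult sum_distrib_left)
  finally show ?case by (simp add: Suc algebra_simps)
qed

text \<open>Each level contributes a factor \<open>p\<close> or \<open>1 - p\<close>. This makes the
  arcs of a level uniformly small, as fine covers require.\<close>

lemma rn_incr_le:
  assumes p: "0 < p" "p < 1" and "i < 2 ^ n"
  shows "rn_incr p n i \<le> max p (1 - p) ^ n"
  using assms(3)
proof (induction n arbitrary: i)
  case 0
  then show ?case by (simp add: rn_incr_def riesz_nagy_outside p)
next
  case (Suc n)
  show ?case
  proof (cases "i < 2 ^ n")
    case True
    then show ?thesis
      using p Suc.IH[OF True] by (auto simp: rn_incr_left_half intro!: mult_mono rn_incr_nonneg)
  next
    case False
    then obtain j where j: "i = 2 ^ n + j" "j < 2 ^ n"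
      using Suc.prems by (metis add_less_cancel_left le_add_diff_inverse mult_2 not_less power_Suc)
    then show ?thesis
      using p Suc.IH[OF j(2)] by (auto simp: rn_incr_right_half intro!: mult_mono rn_incr_nonneg)
  qed
qed

text \<open>\<open>max a b = a + b - min a b\<close> and \<open>min a b \<le> sqrt (a * b)\<close>; the sum of the latter is
  multiplicative over the dyadic levels.\<close>

lemma sum_max_rn_incr_ge:
  assumes p: "0 < p" "p < 1"
  shows "2 - ((sqrt p + sqrt (1 - p)) / sqrt 2) ^ n \<le> (\<Sum>i<2 ^ n. max (1 / 2 ^ n) (rn_incr p n i))"
proof -
  have max_ge: "a + b - sqrt a * sqrt b \<le> max a b" if "0 \<le> a" "0 \<le> b" for a b :: real
  proof -
    have "sqrt (min a b) * sqrt (min a b) \<le> sqrt a * sqrt b"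
      using that by (intro mult_mono) auto
    then show ?thesis using that by (auto simp: max_def min_def split: if_splits)
  qed
  have "((sqrt p + sqrt (1 - p)) / sqrt 2) ^ n = sqrt (1 / 2 ^ n) * (\<Sum>i<2 ^ n. sqrt (rn_incr p n i))"
    by (simp add: sum_sqrt_rn_incr p power_divide real_sqrt_divide real_sqrt_power)
  then have "2 - ((sqrt p + sqrt (1 - p)) / sqrt 2) ^ n
      = (\<Sum>i<2 ^ n. 1 / 2 ^ n + rn_incr p n i - sqrt (1 / 2 ^ n) * sqrt (rn_incr p n i))"
    by (simp add: sum_subtractf sum.distrib sum_rn_incr p sum_distrib_left)
  also have "\<dots> \<le> (\<Sum>i<2 ^ n. max (1 / 2 ^ n) (rn_incr p n i))"
    by (intro sum_mono max_ge rn_incr_nonneg p) auto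
  finally show ?thesis .
qed

section \<open>The graphs\<close>

definition rn_graph :: "real \<Rightarrow> real set \<Rightarrow> (real \<times> real) set" where
  "rn_graph p S = (\<lambda>x. (x, 1 - riesz_nagy p x)) ` S"

lemma compact_rn_graph: "0 < p \<Longrightarrow> p < 1 \<Longrightarrow> compact S \<Longrightarrow> compact (rn_graph p S)"
  unfolding rn_graph_def
  by (intro compact_continuous_image continuous_intros continuous_on_riesz_nagy)

text \<open>Both coordinate projections are 1-Lipschitz; the vertical one covers its interval by the
  intermediate value theorem.\<close>

lemma hausdorff1_rn_graph_ge:
  assumes p: "0 < p" "p < 1" and "a \<le> b"
  shows "ennreal (max (b - a) (riesz_nagy p b - riesz_nagy p a)) \<le> hausdorff1 (rn_graph p {a..b})"
proof -
  have "{a..b} \<subseteq> fst ` rn_graph p {a..b}"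
    by (force simp: rn_graph_def)
  then have x: "ennreal (b - a) \<le> hausdorff1 (rn_graph p {a..b})"
    by (rule hausdorff1_ge_of_lipschitz[OF dist_fst_le])
  have "{1 - riesz_nagy p b..1 - riesz_nagy p a} \<subseteq> snd ` rn_graph p {a..b}"
  proof
    fix y assume "y \<in> {1 - riesz_nagy p b..1 - riesz_nagy p a}"
    then obtain x where "a \<le> x" "x \<le> b" "riesz_nagy p x = 1 - y"
      using IVT'[of "riesz_nagy p" a "1 - y" b] assms continuous_on_riesz_nagy[OF p] by auto
    then show "y \<in> snd ` rn_graph p {a..b}" by (force simp: rn_graph_def)
  qed
  then have "ennreal ((1 - riesz_nagy p a) - (1 - riesz_nagy p b)) \<le> hausdorff1 (rn_graph p {a..b})"
    by (rule hausdorff1_ge_of_lipschitz[OF dist_snd_le])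
  with x show ?thesis by (auto simp: max_def)
qed

text \<open>By monotonicity the arc lies in a box with these side lengths, and the diagonal of a box
  is at most the sum of its sides.\<close>

lemma diameter_rn_graph_le:
  assumes p: "0 < p" "p < 1" and "a \<le> b"
  shows "diameter (rn_graph p {a..b}) \<le> (b - a) + (riesz_nagy p b - riesz_nagy p a)"
proof (rule diameter_le)
  show "rn_graph p {a..b} \<noteq> {} \<or> 0 \<le> b - a + (riesz_nagy p b - riesz_nagy p a)"
    using assms by (simp add: rn_graph_def)
  fix u v assume "u \<in> rn_graph p {a..b}" "v \<in> rn_graph p {a..b}"
  then obtain x y where xy: "x \<in> {a..b}" "y \<in> {a..b}"
    "u = (x, 1 - riesz_nagy p x)" "v = (y, 1 - riesz_nagy p y)"
    by (auto simp: rn_graph_def)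
  have "norm (u - v) \<le> \<bar>x - y\<bar> + \<bar>riesz_nagy p y - riesz_nagy p x\<bar>"
    using sqrt_sum_squares_le_sum_abs[of "x - y" "riesz_nagy p y - riesz_nagy p x"]
    by (simp add: xy norm_prod_def)
  moreover have mono: "riesz_nagy p a \<le> riesz_nagy p z \<and> riesz_nagy p z \<le> riesz_nagy p b" if "z \<in> {a..b}" for z
    using that by (simp add: riesz_nagy_mono p)
  moreover have "\<bar>x - y\<bar> \<le> b - a" using xy(1,2) by auto
  moreover have "\<bar>riesz_nagy p y - riesz_nagy p x\<bar> \<le> riesz_nagy p b - riesz_nagy p a"
    using mono[OF xy(1)] mono[OF xy(2)] by linarith
  ultimately show "norm (u - v) \<le> b - a + (riesz_nagy p b - riesz_nagy p a)" by linarith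
qed

section \<open>The antichain property\<close>

lemma k_antichain_rn_graphs:
  assumes "finite P" "P \<subseteq> {0<..<1}"
  shows "k_antichain (card P) (\<Union>p\<in>P. rn_graph p {0..1})"
  unfolding k_antichain_def
proof (intro conjI allI impI)
  show "(\<Union>p\<in>P. rn_graph p {0..1}) \<subseteq> unit_square"
    using assms riesz_nagy_bounds by (force simp: rn_graph_def)
next
  fix C :: "(real \<times> real) set"
  assume C: "C \<subseteq> unit_square \<and> Complete_Partial_Order.chain (\<le>) C"
  \<comment> \<open>Distinct points of a strictly decreasing graph are incomparable, so a chain
    meets each graph at most once.\<close>
  have eq: "u = v" if "p \<in> P" and uv: "u \<in> rn_graph p {0..1} \<inter> C" "v \<in> rn_graph p {0..1} \<inter> C" for p u v
  proof -
    have p: "0 < p" "p < 1" using assms that(1) by auto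
    obtain x y where xy: "x \<in> {0..1}" "y \<in> {0..1}"
      "u = (x, 1 - riesz_nagy p x)" "v = (y, 1 - riesz_nagy p y)"
      using uv by (auto simp: rn_graph_def)
    have "u \<le> v \<or> v \<le> u" using C uv by (auto simp: chain_def)
    then show "u = v"
      using xy riesz_nagy_strict_mono[OF p, of x y] riesz_nagy_strict_mono[OF p, of y x]
      by (cases x y rule: linorder_cases) (auto simp: less_eq_prod_def)
  qed
  have fin: "finite (rn_graph p {0..1} \<inter> C)" if "p \<in> P" for p
  proof (cases "rn_graph p {0..1} \<inter> C = {}")
    case False
    then obtain u where "u \<in> rn_graph p {0..1} \<inter> C" by blast
    then have "rn_graph p {0..1} \<inter> C \<subseteq> {u}" using eq[OF that] by blast
    then show ?thesis by (rule finite_subset) simp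
  qed simp
  have one: "card (rn_graph p {0..1} \<inter> C) \<le> 1" if "p \<in> P" for p
    using card_le_Suc0_iff_eq[OF fin[OF that]] eq[OF that] by simp
  have split: "(\<Union>p\<in>P. rn_graph p {0..1}) \<inter> C = (\<Union>p\<in>P. rn_graph p {0..1} \<inter> C)" by blast
  show "finite ((\<Union>p\<in>P. rn_graph p {0..1}) \<inter> C)"
    unfolding split by (rule finite_UN_I[OF assms(1) fin])
  show "card ((\<Union>p\<in>P. rn_graph p {0..1}) \<inter> C) \<le> card P"
  proof -
    have "card (\<Union>p\<in>P. rn_graph p {0..1} \<inter> C) \<le> (\<Sum>p\<in>P. card (rn_graph p {0..1} \<inter> C))"
      by (rule card_UN_le[OF assms(1)])
    also have "\<dots> \<le> card P"
      using sum_mono[of P "\<lambda>p. card (rn_graph p {0..1} \<inter> C)" "\<lambda>_. 1"] one by simp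
    finally show ?thesis unfolding split .
  qed
qed

section \<open>Upper bound for the measure\<close>

lemma hausdorff1_rn_graphs_le:
  assumes P: "finite P" "P \<subseteq> {0<..<1}"
  shows "hausdorff1 (\<Union>p\<in>P. rn_graph p {0..1}) \<le> ennreal (2 * real (card P))"
proof (rule hausdorff1_le_finite_covers)
  fix \<delta> :: real assume "0 < \<delta>"
  \<comment> \<open>Since \<open>P\<close> is finite, one level \<open>n\<close> makes the arcs of
    all graphs small enough.\<close>
  have "\<forall>\<^sub>F n in sequentially. \<forall>p\<in>P. (1 / 2) ^ n + max p (1 - p) ^ n < \<delta>"
  proof (rule eventually_ball_finite[OF P(1)], rule ballI)
    fix p assume "p \<in> P"
    then have "(\<lambda>n. (1 / 2) ^ n + max p (1 - p) ^ n) \<longlonglongrightarrow> 0 + 0"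
      using P(2) by (intro tendsto_add LIMSEQ_realpow_zero) auto
    then show "\<forall>\<^sub>F n in sequentially. (1 / 2) ^ n + max p (1 - p) ^ n < \<delta>"
      using \<open>0 < \<delta>\<close> by (intro order_tendstoD) auto
  qed
  then obtain n where n: "\<And>p. p \<in> P \<Longrightarrow> 1 / 2 ^ n + max p (1 - p) ^ n < \<delta>"
    by (auto simp: eventually_sequentially power_one_over)
  define U where "U = (\<lambda>(p, i). rn_graph p {real i / 2 ^ n..real (Suc i) / 2 ^ n})"
  define I where "I = P \<times> {..<2 ^ n :: nat}"
  have diam: "diameter (U (p, i)) \<le> 1 / 2 ^ n + rn_incr p n i" if "p \<in> P" for p i
    using diameter_rn_graph_le[of p "real i / 2 ^ n" "real (Suc i) / 2 ^ n"] that P(2)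
    by (auto simp: U_def rn_incr_def diff_divide_distrib[symmetric] divide_right_mono)
  have "(\<Union>p\<in>P. rn_graph p {0..1}) \<subseteq> (\<Union>t\<in>I. U t)"
  proof
    fix u assume "u \<in> (\<Union>p\<in>P. rn_graph p {0..1})"
    then obtain p x where p: "p \<in> P" and x: "0 \<le> x" "x \<le> 1" and u: "u = (x, 1 - riesz_nagy p x)"
      by (auto simp: rn_graph_def)
    have "\<exists>i<2 ^ n. x \<in> {real i / 2 ^ n..real (Suc i) / 2 ^ n}"
    \<comment> \<open>At \<open>x = 1\<close> the floor would give the index \<open>2 ^ n\<close>,
      one too many; this point belongs to the last arc.\<close>
    proof (cases "x = 1")
      case True
      show ?thesis
        by (rule exI[of _ "2 ^ n - 1"]) (simp add: True of_nat_diff)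
    next
      case False
      define i where "i = nat \<lfloor>x * 2 ^ n\<rfloor>"
      have i: "real i \<le> x * 2 ^ n" "x * 2 ^ n < real i + 1"
        using x by (simp_all add: i_def)
      moreover have "x * 2 ^ n < 1 * 2 ^ n" using x False by (intro mult_strict_right_mono) auto
      ultimately have "real i < 2 ^ n" by linarith
      then have "i < 2 ^ n" by (metis of_nat_less_iff of_nat_numeral of_nat_power)
      then show ?thesis using i by (auto intro!: exI[of _ i] simp: field_simps)
    qed
    then obtain i where "i < 2 ^ n" "x \<in> {real i / 2 ^ n..real (Suc i) / 2 ^ n}" by blast
    then have "u \<in> U (p, i)" "(p, i) \<in> I"
      using p u by (simp_all add: I_def U_def rn_graph_def)
    then show "u \<in> (\<Union>t\<in>I. U t)" by blast
  qed
  moreover have "\<forall>t\<in>I. bounded (U t) \<and> diameter (U t) \<le> \<delta>"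
  proof safe
    fix p i assume "(p, i) \<in> I"
    then have pi: "p \<in> P" "0 < p" "p < 1" "i < 2 ^ n" using P(2) by (auto simp: I_def)
    show "bounded (U (p, i))"
      using pi by (auto simp: U_def intro!: compact_imp_bounded compact_rn_graph)
    show "diameter (U (p, i)) \<le> \<delta>"
      using diam[OF pi(1), of i] n[OF pi(1)] rn_incr_le[OF pi(2-4)] by linarith
  qed
  moreover have "(\<Sum>t\<in>I. diameter (U t)) \<le> 2 * real (card P)"
  proof -
    have "(\<Sum>t\<in>I. diameter (U t)) = (\<Sum>p\<in>P. \<Sum>i<2 ^ n. diameter (U (p, i)))"
      by (simp add: I_def sum.cartesian_product)
    also have "\<dots> \<le> (\<Sum>p\<in>P. \<Sum>i<2 ^ n. 1 / 2 ^ n + rn_incr p n i)"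
      by (intro sum_mono diam)
    \<comment> \<open>On each graph the widths add up to 1 and so do the heights.\<close>
    also have "\<dots> = (\<Sum>p\<in>P. 2)"
      using P(2) by (intro sum.cong refl) (auto simp: sum.distrib sum_rn_incr)
    finally show ?thesis by (simp add: mult.commute)
  qed
  moreover have "finite I" using P(1) by (simp add: I_def)
  ultimately show "\<exists>(I :: (real \<times> nat) set) U. finite I \<and> (\<Union>p\<in>P. rn_graph p {0..1}) \<subseteq> (\<Union>i\<in>I. U i) \<and>
     (\<forall>i\<in>I. bounded (U i) \<and> diameter (U i) \<le> \<delta>) \<and> (\<Sum>i\<in>I. diameter (U i)) \<le> 2 * real (card P)"
    by blast
qed

section \<open>Lower bound for the measure\<close>

text \<open>Adjacent dyadic arcs share an endpoint, and all graphs meet at \<open>(0, 1)\<close> and \<open>(1, 0)\<close>;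
  shortening the arcs by \<open>\<eta>\<close> at both ends makes them disjoint.\<close>

lemma disjoint_family_rn_graph_arcs:
  assumes P: "P \<subseteq> {0<..<1}" and \<eta>: "0 < \<eta>"
  shows "disjoint_family_on (\<lambda>(p, i). rn_graph p {real i / 2 ^ n + \<eta>..real (Suc i) / 2 ^ n - \<eta>})
    (P \<times> {..<2 ^ n})"
  unfolding disjoint_family_on_def
proof (clarsimp, rule ccontr)
  fix p i q j
  assume pq: "p \<in> P" "q \<in> P" and ij: "i < 2 ^ n" "j < 2 ^ n" and ne: "p = q \<longrightarrow> i \<noteq> j"
    and "rn_graph p {real i / 2 ^ n + \<eta>..(1 + real i) / 2 ^ n - \<eta>} \<inter>
      rn_graph q {real j / 2 ^ n + \<eta>..(1 + real j) / 2 ^ n - \<eta>} \<noteq> {}"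
  then obtain x where x: "real i / 2 ^ n + \<eta> \<le> x" "x \<le> (1 + real i) / 2 ^ n - \<eta>"
      "real j / 2 ^ n + \<eta> \<le> x" "x \<le> (1 + real j) / 2 ^ n - \<eta>" and F: "riesz_nagy p x = riesz_nagy q x"
    by (auto simp: rn_graph_def)
  have "real i / 2 ^ n < (1 + real j) / 2 ^ n" "real j / 2 ^ n < (1 + real i) / 2 ^ n"
    using x \<eta> by linarith+
  then have "i = j" by (simp add: divide_less_cancel)
  then have "p \<noteq> q" using ne by simp
  have "0 \<le> real i / 2 ^ n" by simp
  then have "0 < x" using x \<eta> by linarith
  have "real (Suc i) \<le> real (2 ^ n)" using ij by (intro of_nat_mono) simp
  then have "(1 + real i) / 2 ^ n \<le> 1" by simp
  then have "x < 1" using x \<eta> by linarith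
  moreover have "0 < p" "p < 1" "0 < q" "q < 1" using pq P by auto
  ultimately show False
    using F riesz_nagy_strict_mono_param[of p q x] riesz_nagy_strict_mono_param[of q p x]
      \<open>p \<noteq> q\<close> \<open>0 < x\<close> by (cases p q rule: linorder_cases) auto
qed

text \<open>The projection bounds add up over the shortened arcs, which are disjoint and compact.
  Letting \<open>\<eta>\<close> tend to 0 recovers the full arcs, by continuity of the
  functions.\<close>

lemma hausdorff1_rn_graphs_ge_sum:
  assumes P: "finite P" "P \<subseteq> {0<..<1}"
  shows "ennreal (\<Sum>p\<in>P. \<Sum>i<2 ^ n. max (1 / 2 ^ n) (rn_incr p n i))
    \<le> hausdorff1 (\<Union>p\<in>P. rn_graph p {0..1})"
proof -
  let ?l = "\<lambda>\<eta> i. real i / 2 ^ n + \<eta>" and ?r = "\<lambda>\<eta> i. real (Suc i) / 2 ^ n - \<eta>"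
  let ?m = "\<lambda>p i \<eta>. max (?r \<eta> i - ?l \<eta> i) (riesz_nagy p (?r \<eta> i) - riesz_nagy p (?l \<eta> i))"
  let ?S = "\<lambda>\<eta>. \<Sum>p\<in>P. \<Sum>i<2 ^ n. ?m p i \<eta>"
  have "(?S \<longlongrightarrow> (\<Sum>p\<in>P. \<Sum>i<2 ^ n. ?m p i 0)) (at_right 0)"
  proof (intro tendsto_sum)
    fix p and i :: nat assume "p \<in> P"
    then have c: "isCont (riesz_nagy p) x" for x
      using P(2) continuous_on_riesz_nagy[of p UNIV] by (auto simp: continuous_on_eq_continuous_at)
    show "(?m p i \<longlongrightarrow> ?m p i 0) (at_right 0)"
      by (intro tendsto_intros isCont_tendsto_compose[OF c])
  qed
  moreover have "?m p i 0 = max (1 / 2 ^ n) (rn_incr p n i)" for p i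
    by (simp add: rn_incr_def diff_divide_distrib[symmetric])
  ultimately have lim: "((\<lambda>\<eta>. ennreal (?S \<eta>)) \<longlongrightarrow>
      ennreal (\<Sum>p\<in>P. \<Sum>i<2 ^ n. max (1 / 2 ^ n) (rn_incr p n i))) (at_right 0)"
    by (intro tendsto_ennrealI) (simp only:)
  have "ennreal (?S \<eta>) \<le> hausdorff1 (\<Union>p\<in>P. rn_graph p {0..1})"
    \<comment> \<open>Less than half the width of an arc, so the shortened intervals are
      nonempty.\<close>
    if "0 < \<eta>" "\<eta> < 1 / 2 ^ Suc n" for \<eta>
  proof -
    define K where "K = (\<lambda>(p, i). rn_graph p {?l \<eta> i..?r \<eta> i})"
    define I where "I = P \<times> {..<2 ^ n :: nat}"
    have lr: "?l \<eta> i \<le> ?r \<eta> i" for i using that by (simp add: field_simps)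
    have nonneg: "0 \<le> ?m p i \<eta>" for p i
      using lr[of i] by (intro max.coboundedI1) linarith
    have "ennreal (?S \<eta>) = (\<Sum>p\<in>P. ennreal (\<Sum>i<2 ^ n. ?m p i \<eta>))"
      by (intro sum_ennreal[symmetric] sum_nonneg nonneg)
    also have "\<dots> = (\<Sum>p\<in>P. \<Sum>i<2 ^ n. ennreal (?m p i \<eta>))"
      by (intro sum.cong refl sum_ennreal[symmetric] nonneg)
    also have "\<dots> = (\<Sum>(p, i)\<in>I. ennreal (?m p i \<eta>))"
      by (simp add: I_def sum.cartesian_product)
    also have "\<dots> \<le> (\<Sum>t\<in>I. hausdorff1 (K t))"
    proof (rule sum_mono, clarify)
      fix p i assume "(p, i) \<in> I"
      then show "ennreal (?m p i \<eta>) \<le> hausdorff1 (K (p, i))"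
        using hausdorff1_rn_graph_ge[OF _ _ lr, of p i] P(2) by (auto simp: K_def I_def)
    qed
    also have "\<dots> \<le> hausdorff1 (\<Union>t\<in>I. K t)"
    proof (rule sum_hausdorff1_le)
      show "finite I" using P(1) by (simp add: I_def)
      show "disjoint_family_on K I"
        unfolding K_def I_def by (rule disjoint_family_rn_graph_arcs[OF P(2) that(1)])
      show "compact (K t)" if "t \<in> I" for t
        using that P(2) by (auto simp: K_def I_def intro!: compact_rn_graph)
    qed
    also have "\<dots> \<le> hausdorff1 (\<Union>p\<in>P. rn_graph p {0..1})"
    proof (intro hausdorff1_mono UN_least)
      fix t assume "t \<in> I"
      then obtain p i where t: "t = (p, i)" "p \<in> P" "i < 2 ^ n" by (auto simp: I_def)
      have "real (Suc i) \<le> real (2 ^ n)" using t(3) by (intro of_nat_mono) simp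
      then have "real (Suc i) / 2 ^ n \<le> 1" by simp
      moreover have "0 \<le> real i / 2 ^ n" by simp
      ultimately have "{?l \<eta> i..?r \<eta> i} \<subseteq> {0..1}"
        using \<open>0 < \<eta>\<close> by (intro atLeastatMost_subset_iff[THEN iffD2]) linarith
      then show "K t \<subseteq> (\<Union>p\<in>P. rn_graph p {0..1})"
        using t by (fastforce simp: K_def rn_graph_def)
    qed
    finally show ?thesis .
  qed
  then have "\<forall>\<^sub>F \<eta> in at_right 0. ennreal (?S \<eta>) \<le> hausdorff1 (\<Union>p\<in>P. rn_graph p {0..1})"
    by (intro eventually_at_rightI[of 0 "1 / 2 ^ Suc n"]) auto
  with lim show ?thesis by (rule tendsto_upperbound) simp
qed

lemma hausdorff1_rn_graphs_ge:
  assumes P: "finite P" "P \<subseteq> {0<..<1 / 2}"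
  shows "ennreal (2 * real (card P)) \<le> hausdorff1 (\<Union>p\<in>P. rn_graph p {0..1})"
proof -
  let ?c = "\<lambda>p. (sqrt p + sqrt (1 - p)) / sqrt 2"
  have P': "P \<subseteq> {0<..<1}" using P(2) by force
  have c: "0 \<le> ?c p \<and> ?c p < 1" if "p \<in> P" for p
  proof -
    have p: "0 < p" "p < 1 / 2" using P(2) that by auto
    \<comment> \<open>Strict because \<open>p\<close> differs from \<open>1 / 2\<close>. It gives
      \<open>p * (1 - p) < 1 / 4\<close>, and \<open>(sqrt p + sqrt (1 - p)) ^ 2\<close> equals
      \<open>1 + 2 * sqrt (p * (1 - p))\<close>.\<close>
    have "0 < (1 - 2 * p) ^ 2" using p by simp
    then have "p * (1 - p) < (1 / 2) ^ 2" by (simp add: power2_eq_square algebra_simps)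
    then have "sqrt (p * (1 - p)) < 1 / 2" by (intro real_less_lsqrt) auto
    then have "(sqrt p + sqrt (1 - p)) ^ 2 < 2" using p by (simp add: power2_sum real_sqrt_mult)
    then have "sqrt p + sqrt (1 - p) < sqrt 2" by (rule real_less_rsqrt)
    then show ?thesis using p by simp
  qed
  have "(\<lambda>n. \<Sum>p\<in>P. 2 - ?c p ^ n) \<longlonglongrightarrow> (\<Sum>p\<in>P. 2 - 0)"
    using c by (intro tendsto_sum tendsto_diff tendsto_const LIMSEQ_realpow_zero) auto
  then have lim: "(\<lambda>n. ennreal (\<Sum>p\<in>P. 2 - ?c p ^ n)) \<longlonglongrightarrow> ennreal (2 * real (card P))"
    by (intro tendsto_ennrealI) (simp add: mult.commute)
  have "ennreal (\<Sum>p\<in>P. 2 - ?c p ^ n) \<le> hausdorff1 (\<Union>p\<in>P. rn_graph p {0..1})" for n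
  proof -
    have "(\<Sum>p\<in>P. 2 - ?c p ^ n) \<le> (\<Sum>p\<in>P. \<Sum>i<2 ^ n. max (1 / 2 ^ n) (rn_incr p n i))"
      using P' by (intro sum_mono sum_max_rn_incr_ge) auto
    then show ?thesis
      using hausdorff1_rn_graphs_ge_sum[OF P(1) P', of n] ennreal_leI order.trans by blast
  qed
  then show ?thesis
    by (intro tendsto_upperbound[OF lim] always_eventually allI) simp_all
qed

theorem theorem1p6:
  fixes k :: nat
  assumes "k > 0"
  shows "\<exists>A :: (real \<times> real) set. k_antichain k A \<and> hausdorff1 A = ennreal (2 * real k)"
proof -
  \<comment> \<open>Any \<open>k\<close> distinct parameters below \<open>1 / 2\<close> serve; an
    infinite interval supplies them.\<close>
  have "infinite {0<..<1 / 2 :: real}" by (simp add: infinite_Ioo)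
  then obtain P :: "real set" where P: "finite P" "card P = k" "P \<subseteq> {0<..<1 / 2}"
    using infinite_arbitrarily_large by blast
  then have P': "P \<subseteq> {0<..<1}" by force
  show ?thesis
    using k_antichain_rn_graphs[OF P(1) P'] hausdorff1_rn_graphs_le[OF P(1) P']
      hausdorff1_rn_graphs_ge[OF P(1,3)] P(2)
    by (intro exI[of _ "\<Union>p\<in>P. rn_graph p {0..1}"]) simp
qed

end
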